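(* There is a nonempty class of polynomials $P(x)=\sum_{i=0}^d a_i x^i\in\mathbb{R}[x]$ such that, for each $P$ in the class, the dimension spectrum of the graph $S=\{(x,P(x)):x\in\mathbb{R}\}$ has diameter strictly greater than $1$, i.e. $\mathrm{diam}\,\mathrm{sp}(S)>1$.
   Context: Fix a universal prefix Turing machine $U$ and a binary encoding of tuples of rationals by finite binary strings. $K(q)$ denotes the prefix Kolmogorov complexity of (the encoding of) $q$, i.e. the length of a shortest program $\pi$ on which $U$ outputs $q$. For $z\in\mathbb{R}^m$ and $r\in\mathbb{N}$, $K_r(z)=\min\{K(q): q\in\mathbb{Q}^m\cap B(z,2^{-r})\}$, where $B(z,\rho)$ is the open Euclidean ball of radius $\rho$ about $z$. The effective Hausdorff dimension of $z\in\mathbb{R}^m$ is $\dim(z)=\liminf_{r\to\infty}K_r(z)/r$. For $S\subseteq\mathbb{R}^n$, the dimension spectrum of $S$ is $\mathrm{sp}(S)=\{\dim(z): z\in S\}\subseteq\mathbb{R}$; its diameter is $\mathrm{diam}\,\mathrm{sp}(S)=\sup\{|u-v|:u,v\in\mathrm{sp}(S)\}$. *)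

theory Defs
  imports "HOL-Analysis.Analysis" "HOL-Computational_Algebra.Polynomial" "HOL-Library.Sublist"
begin

datatype tape_symbol = Blank | Bit bool | Aux nat

datatype move = MoveL | Stay | MoveR

text \<open>
  A machine is its instruction table on one two-way infinite tape. State \<open>0\<close> is initial,
  and a machine halts when the table has no instruction for the current state and scanned
  symbol. Finiteness of the table bounds the states and the alphabet.
\<close>

type_synonym tm = "nat \<times> tape_symbol \<Rightarrow> (nat \<times> tape_symbol \<times> move) option"

definition turing_machine :: "tm \<Rightarrow> bool" where
  "turing_machine M \<longleftrightarrow> finite (dom M)"

text \<open>State, head position, tape content.\<close>

type_synonym tm_config = "nat \<times> int \<times> (int \<Rightarrow> tape_symbol)"

fun move_head :: "move \<Rightarrow> int \<Rightarrow> int" where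
  "move_head MoveL h = h - 1"
| "move_head Stay h = h"
| "move_head MoveR h = h + 1"

fun tm_halted :: "tm \<Rightarrow> tm_config \<Rightarrow> bool" where
  "tm_halted M (s, h, t) \<longleftrightarrow> M (s, t h) = None"

fun tm_step :: "tm \<Rightarrow> tm_config \<Rightarrow> tm_config" where
  "tm_step M (s, h, t) =
     (case M (s, t h) of
        None \<Rightarrow> (s, h, t)
      | Some (s', x, d) \<Rightarrow> (s', move_head d h, t(h := x)))"

definition tm_init :: "bool list \<Rightarrow> tm_config" where
  "tm_init p = (0, 0, \<lambda>i. if 0 \<le> i \<and> i < int (length p) then Bit (p ! nat i) else Blank)"

text \<open>The output is the maximal block of bits that begins at the head and extends to the right.\<close>

fun tm_output :: "tm_config \<Rightarrow> bool list" where
  "tm_output (s, h, t) =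
     map (\<lambda>i. t (h + int i) = Bit True) [0..<(LEAST n. t (h + int n) \<notin> range Bit)]"

definition tm_fun :: "tm \<Rightarrow> bool list \<Rightarrow> bool list option" where
  "tm_fun M p =
     (if \<exists>n. tm_halted M ((tm_step M ^^ n) (tm_init p))
      then Some (tm_output ((tm_step M ^^ (LEAST n. tm_halted M ((tm_step M ^^ n) (tm_init p)))) (tm_init p)))
      else None)"

definition prefix_free :: "bool list set \<Rightarrow> bool" where
  "prefix_free A \<longleftrightarrow> (\<forall>p\<in>A. \<forall>q\<in>A. prefix p q \<longrightarrow> p = q)"

definition prefix_machine :: "tm \<Rightarrow> bool" where
  "prefix_machine M \<longleftrightarrow> turing_machine M \<and> prefix_free (dom (tm_fun M))"

definition universal_prefix_machine :: "tm \<Rightarrow> bool" where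
  "universal_prefix_machine U \<longleftrightarrow>
     prefix_machine U \<and>
     (\<forall>M. prefix_machine M \<longrightarrow> (\<exists>c. \<forall>p. tm_fun U (c @ p) = tm_fun M p))"

text \<open>
  A reference presentation of rational tuples, in which each rational is given by its sign and
  the unary numerals of its reduced numerator and denominator. It only serves to say
  what it means for an arbitrary encoding to be computable.
\<close>

definition rat_presentation :: "rat \<Rightarrow> bool list" where
  "rat_presentation q =
     (case quotient_of q of
        (a, b) \<Rightarrow> [a < 0] @ replicate (nat \<bar>a\<bar>) True @ [False] @ replicate (nat b) True @ [False])"

text \<open>
  The inverse of a computable injection is partial computable, so decoding needs no separate
  condition.
\<close>

definition rat_tuple_encoding :: "(rat list \<Rightarrow> bool list) \<Rightarrow> bool" where
  "rat_tuple_encoding e \<longleftrightarrow>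
     inj e \<and>
     (\<exists>M. turing_machine M \<and>
          (\<forall>qs. tm_fun M (concat (map rat_presentation qs)) = Some (e qs)))"

text \<open>
  In the order of the numeral type \<open>2\<close> the index \<open>2 = 0\<close> precedes \<open>1\<close>. A permutation of
  the coordinates changes complexities by a bounded amount only.
\<close>

definition tuple_of :: "'a ^ 'm::{finite,linorder} \<Rightarrow> 'a list" where
  "tuple_of q = map (\<lambda>i. q $ i) (sorted_list_of_set UNIV)"

text \<open>
  For universal \<open>U\<close> every string has a program, and rational points are dense, so the least
  elements below are minima of nonempty sets of natural numbers.
\<close>

definition complexity :: "tm \<Rightarrow> (rat list \<Rightarrow> bool list) \<Rightarrow> rat ^ 'm::{finite,linorder} \<Rightarrow> nat" where
  "complexity U e q = (LEAST n. \<exists>p. length p = n \<and> tm_fun U p = Some (e (tuple_of q)))"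

definition complexity_at ::
  "tm \<Rightarrow> (rat list \<Rightarrow> bool list) \<Rightarrow> nat \<Rightarrow> real ^ 'm::{finite,linorder} \<Rightarrow> nat" where
  "complexity_at U e r z =
     (INF q \<in> {q. (\<chi> i. of_rat (q $ i)) \<in> ball z ((1 / 2) ^ r)}. complexity U e q)"

definition effective_dim ::
  "tm \<Rightarrow> (rat list \<Rightarrow> bool list) \<Rightarrow> real ^ 'm::{finite,linorder} \<Rightarrow> ereal" where
  "effective_dim U e z = liminf (\<lambda>r. ereal (real (complexity_at U e r z) / real r))"

definition dim_spectrum ::
  "tm \<Rightarrow> (rat list \<Rightarrow> bool list) \<Rightarrow> (real ^ 'm::{finite,linorder}) set \<Rightarrow> ereal set" where
  "dim_spectrum U e S = effective_dim U e ` S"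

text \<open>
  For universal \<open>U\<close> a spectrum consists of finite values, on which the extended
  real operations are those of the reals.
\<close>

definition spectrum_diam :: "ereal set \<Rightarrow> ereal" where
  "spectrum_diam A = (SUP (u, v) \<in> A \<times> A. \<bar>u - v\<bar>)"

definition poly_graph :: "real poly \<Rightarrow> (real ^ 2) set" where
  "poly_graph P = {vector [x, poly P x] | x. x \<in> UNIV}"

end

theory Submission
  imports Defs
begin

text \<open>
  A line through the origin already has a spectrum of diameter greater than \<open>1\<close>, for a suitable
  slope. The origin is a rational point, so one fixed program approximates it at every precision
  and its dimension is \<open>0\<close>. It therefore suffices to find a point \<open>(x, y)\<close> with \<open>x \<noteq> 0\<close>
  whose dimension exceeds \<open>1\<close>: the line \<open>t \<mapsto> (y / x) * t\<close> passes through it.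

  Such points exist because they fill the plane up to a null set (\<open>AE_effective_dim_ge\<close>).
  If \<open>dim z < s\<close>, then for infinitely many \<open>r\<close> the point \<open>z\<close> lies within \<open>2\<^sup>-\<^sup>r\<close> of a rational
  point with a program of length at most \<open>s * r\<close>. There are fewer than \<open>2 * 2 powr (s * r)\<close> such
  programs, so the corresponding balls in dimension \<open>m\<close> have total volume
  \<open>O(2 powr ((s - m) * r))\<close>. For \<open>s < m\<close> this is summable, and the Borel--Cantelli lemma applies.

  The counting argument needs the complexity of a rational point to be the length of a genuine
  program for it. This is the one place where universality of the reference machine enters: every
  string is written by some prefix machine that accepts only the empty input.
\<close>

section \<open>Every string has a program\<close>

text \<open>
  The table writes \<open>s\<close> on an empty tape from right to left, so that the head finishes at the left
  end of the block, where the output is read. On a nonempty input it loops, which keeps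
  the domain prefix-free.
\<close>

definition writer :: "bool list \<Rightarrow> tm" where
  "writer s = (\<lambda>(i, x). case x of
       Blank \<Rightarrow> if i < length s then Some (Suc i, Bit (rev s ! i), MoveL)
               else if i = length s then Some (Suc i, Blank, MoveR) else None
     | Bit b \<Rightarrow> if i = 0 then Some (0, Bit b, Stay) else None
     | Aux _ \<Rightarrow> None)"

lemma turing_machine_writer: "turing_machine (writer s)"
proof -
  have "dom (writer s) \<subseteq> ({..length s} \<times> {Blank}) \<union> ({0} \<times> {Bit True, Bit False})"
  proof
    fix y assume "y \<in> dom (writer s)"
    then obtain i x where y: "y = (i, x)" "writer s (i, x) \<noteq> None" by (cases y) auto
    show "y \<in> ({..length s} \<times> {Blank}) \<union> ({0} \<times> {Bit True, Bit False})"
      using y by (cases x) (auto simp: writer_def split: if_splits)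
  qed
  then show ?thesis unfolding turing_machine_def by (rule finite_subset) auto
qed

lemma writer_run:
  assumes "k \<le> length s"
  shows "(tm_step (writer s) ^^ k) (tm_init []) =
    (k, - int k, \<lambda>i. if - int k < i \<and> i \<le> 0 then Bit (rev s ! nat (- i)) else Blank)"
  using assms
proof (induction k)
  case 0
  then show ?case by (auto simp: tm_init_def fun_eq_iff)
next
  case (Suc k)
  then show ?case by (auto simp: writer_def fun_eq_iff)
qed

lemma tm_fun_writer_Nil: "tm_fun (writer s) [] = Some s"
proof -
  let ?M = "writer s" and ?n = "length s"
  define t where "t = (\<lambda>i. if - int ?n < i \<and> i \<le> 0 then Bit (rev s ! nat (- i)) else Blank)"
  have run: "(tm_step ?M ^^ ?n) (tm_init []) = (?n, - int ?n, t)"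
    using writer_run[of ?n s] by (simp add: t_def)
  have fin: "(tm_step ?M ^^ Suc ?n) (tm_init []) = (Suc ?n, 1 - int ?n, t)"
    by (simp only: funpow.simps o_apply run) (auto simp: writer_def t_def fun_eq_iff)
  have halts: "tm_halted ?M ((tm_step ?M ^^ Suc ?n) (tm_init []))"
    by (simp only: fin) (auto simp: writer_def t_def split: tape_symbol.split)
  have runs: "\<not> tm_halted ?M ((tm_step ?M ^^ k) (tm_init []))" if "k \<le> ?n" for k
    using that by (simp add: writer_run) (auto simp: writer_def)
  have least: "(LEAST n. tm_halted ?M ((tm_step ?M ^^ n) (tm_init []))) = Suc ?n"
  proof (rule Least_equality)
    show "Suc ?n \<le> k" if "tm_halted ?M ((tm_step ?M ^^ k) (tm_init []))" for k
      using runs that not_less_eq_eq by blast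
  qed (rule halts)
  have t: "t (1 - int ?n + int j) = (if j < ?n then Bit (s ! j) else Blank)" for j
  proof (cases "j < ?n")
    case True
    have "nat (- (1 - int ?n + int j)) = ?n - Suc j" using True by auto
    then show ?thesis using True by (auto simp: t_def rev_nth)
  qed (auto simp: t_def)
  have "(LEAST j. t (1 - int ?n + int j) \<notin> range Bit) = ?n"
    unfolding t by (rule Least_equality) (auto split: if_splits)
  then have "tm_output (Suc ?n, 1 - int ?n, t) = s"
    unfolding tm_output.simps t by (auto intro!: nth_equalityI)
  moreover have "\<exists>n. tm_halted ?M ((tm_step ?M ^^ n) (tm_init []))"
    using halts by blast
  ultimately show ?thesis
    unfolding tm_fun_def least fin by (simp only: if_True)
qed

lemma tm_fun_writer_nonempty:
  assumes "p \<noteq> []"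
  shows "tm_fun (writer s) p = None"
proof -
  obtain h t where init: "tm_init p = (0, h, t)" "t h = Bit (p ! 0)"
    using assms by (auto simp: tm_init_def)
  then have "tm_step (writer s) (tm_init p) = tm_init p"
    by (auto simp: writer_def)
  then have "(tm_step (writer s) ^^ n) (tm_init p) = tm_init p" for n
    by (induction n) auto
  moreover have "\<not> tm_halted (writer s) (tm_init p)"
    using init by (auto simp: writer_def)
  ultimately show ?thesis by (simp add: tm_fun_def)
qed

lemma prefix_machine_writer: "prefix_machine (writer s)"
proof -
  have "dom (tm_fun (writer s)) \<subseteq> {[]}"
    using tm_fun_writer_nonempty[of _ s] by force
  then show ?thesis
    using turing_machine_writer by (force simp: prefix_machine_def prefix_free_def)
qed

lemma universal_has_program:
  assumes "universal_prefix_machine U"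
  shows "\<exists>p. tm_fun U p = Some s"
  using assms prefix_machine_writer[of s] tm_fun_writer_Nil[of s]
  unfolding universal_prefix_machine_def by metis

section \<open>Counting points of low complexity\<close>

lemma inj_tuple_of: "inj (tuple_of :: 'a ^ 'm::{finite,linorder} \<Rightarrow> 'a list)"
  by (rule injI) (simp add: tuple_of_def vec_eq_iff)

lemma complexity_attained:
  assumes "universal_prefix_machine U"
  shows "\<exists>p. length p = complexity U e q \<and> tm_fun U p = Some (e (tuple_of q))"
  unfolding complexity_def
  by (rule LeastI_ex) (use universal_has_program[OF assms] in blast)

text \<open>
  Distinct rational points have distinct shortest programs, since a program determines its output
  and the encoding is injective; and there are \<open>2 ^ Suc n - 1\<close> strings of length at most \<open>n\<close>.
\<close>

lemma complexity_le_finite_card: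
  fixes U e n
  defines "Q \<equiv> {q :: rat ^ 'm::{finite,linorder}. complexity U e q \<le> n}"
  assumes U: "universal_prefix_machine U" and e: "inj e"
  shows "finite Q" and "card Q \<le> 2 ^ Suc n"
proof -
  obtain prog :: "rat ^ 'm::{finite,linorder} \<Rightarrow> bool list" where
    len: "\<And>q. length (prog q) = complexity U e q" and
    prog: "\<And>q. tm_fun U (prog q) = Some (e (tuple_of q))"
    using complexity_attained[OF U] by metis
  have "inj prog"
    by (rule injI) (metis prog option.inject e inj_tuple_of injD)
  then have inj: "inj_on prog Q" by (rule inj_on_subset) simp
  let ?S = "{p :: bool list. set p \<subseteq> UNIV \<and> length p \<le> n}"
  have sub: "prog ` Q \<subseteq> ?S" by (auto simp: Q_def len)
  have fin: "finite ?S" by (rule finite_lists_length_le) simp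
  then show "finite Q" using sub inj by (meson finite_imageD finite_subset)
  have "card Q \<le> card ?S" using inj sub fin by (rule card_inj_on_le)
  also have "\<dots> = (\<Sum>i\<le>n. 2 ^ i)"
    by (subst card_lists_length_le) (simp_all add: card_UNIV_bool)
  also have "\<dots> \<le> (2::nat) ^ Suc n"
    by (induction n) auto
  finally show "card Q \<le> 2 ^ Suc n" .
qed

abbreviation real_point :: "rat ^ 'm \<Rightarrow> real ^ 'm::finite" where
  "real_point q \<equiv> \<chi> i. of_rat (q $ i)"

lemma rational_point_in_ball:
  fixes z :: "real ^ 'm::finite"
  assumes "\<epsilon> > 0"
  shows "\<exists>q. real_point q \<in> ball z \<epsilon>"
proof -
  define \<delta> where "\<delta> = \<epsilon> / real CARD('m)"
  have "\<delta> > 0" using assms by (simp add: \<delta>_def)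
  then have "\<exists>a. z $ i < of_rat a \<and> of_rat a < z $ i + \<delta>" for i
    using of_rat_dense[of "z $ i" "z $ i + \<delta>"] by auto
  then obtain a where a: "\<And>i. z $ i < of_rat (a i) \<and> of_rat (a i) < z $ i + \<delta>" by metis
  have "norm (z - real_point (\<chi> i. a i)) \<le> (\<Sum>i\<in>UNIV. \<bar>z $ i - of_rat (a i)\<bar>)"
    by (rule order_trans[OF norm_le_l1_cart]) simp
  also have "\<dots> < (\<Sum>i\<in>(UNIV::'m set). \<delta>)"
    by (rule sum_strict_mono) (use a in \<open>auto simp: abs_if algebra_simps\<close>)
  also have "\<dots> = \<epsilon>" by (simp add: \<delta>_def)
  finally show ?thesis by (intro exI[of _ "\<chi> i. a i"]) (simp add: dist_norm)
qed

lemma complexity_at_attained: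
  fixes z :: "real ^ 'm::{finite,linorder}"
  shows "\<exists>q. real_point q \<in> ball z ((1 / 2) ^ r) \<and> complexity_at U e r z = complexity U e q"
proof -
  let ?Q = "{q. real_point q \<in> ball z ((1 / 2) ^ r)}"
  have "?Q \<noteq> {}" using rational_point_in_ball[of "(1 / 2) ^ r" z] by auto
  then have "Inf (complexity U e ` ?Q) \<in> complexity U e ` ?Q"
    by (intro Inf_nat_def1) simp
  then show ?thesis unfolding complexity_at_def by blast
qed

section \<open>Points of extreme dimension\<close>

text \<open>A rational point approximates itself at every precision, at constant cost.\<close>

lemma effective_dim_rational:
  "effective_dim U e (real_point q :: real ^ 'm::{finite,linorder}) = 0"
proof -
  let ?z = "real_point q" and ?c = "real (complexity U e q)"
  have le: "complexity_at U e r ?z \<le> complexity U e q" for r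
    unfolding complexity_at_def by (rule cINF_lower) auto
  have "(\<lambda>r. real (complexity_at U e r ?z) / real r) \<longlonglongrightarrow> 0"
  proof (rule tendsto_sandwich[of "\<lambda>_. 0" _ _ "\<lambda>r. ?c / real r"])
    show "(\<lambda>r. ?c / real r) \<longlonglongrightarrow> 0" by (rule lim_const_over_n)
  qed (use le in \<open>auto intro!: always_eventually divide_right_mono\<close>)
  then have "(\<lambda>r. ereal (real (complexity_at U e r ?z) / real r)) \<longlonglongrightarrow> ereal 0"
    by (rule tendsto_ereal)
  then show ?thesis
    unfolding effective_dim_def by (simp add: lim_imp_Liminf zero_ereal_def)
qed

text \<open>
  The points that have, at precision \<open>r\<close>, an approximation of complexity at most \<open>s * r\<close> lie in
  a union \<open>A r\<close> of at most \<open>2 * 2 powr (s * r)\<close> balls of radius \<open>2\<^sup>-\<^sup>r\<close>. These volumes decay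
  geometrically in \<open>r\<close>, so almost every point leaves the sets \<open>A r\<close> eventually, and then the
  quotients in the lower limit are at least \<open>s\<close> from some precision on.
\<close>

lemma AE_effective_dim_ge:
  fixes s :: real
  assumes U: "universal_prefix_machine U" and e: "inj e"
    and s: "0 \<le> s" "s < CARD('m)"
  shows "AE z :: real ^ 'm::{finite,linorder} in lborel. ereal s \<le> effective_dim U e z"
proof -
  let ?m = "CARD('m)"
  define Q where "Q r = {q :: rat ^ 'm::{finite,linorder}. complexity U e q \<le> nat \<lfloor>s * real r\<rfloor>}" for r :: nat
  define A where "A r = (\<Union>q\<in>Q r. ball (real_point q) ((1 / 2) ^ r))" for r
  define V where "V = unit_ball_vol (real ?m)"
  have finQ: "finite (Q r)" for r
    unfolding Q_def by (rule complexity_le_finite_card[OF U e])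
  have "card (Q r) \<le> 2 ^ Suc (nat \<lfloor>s * real r\<rfloor>)" for r
    unfolding Q_def by (rule complexity_le_finite_card[OF U e])
  then have "real (card (Q r)) \<le> 2 * 2 ^ nat \<lfloor>s * real r\<rfloor>" for r
    by (metis of_nat_le_iff of_nat_numeral of_nat_power power_Suc)
  moreover have "2 ^ nat \<lfloor>s * real r\<rfloor> \<le> 2 powr (s * real r)" for r
    using s by (subst powr_realpow[symmetric]) (auto intro!: powr_mono)
  ultimately have cardQ: "real (card (Q r)) \<le> 2 * 2 powr (s * real r)" for r
    by (smt (verit))
  have ball: "emeasure lborel (ball c ((1 / 2) ^ r)) = ennreal (V * ((1 / 2) ^ r) ^ ?m)"
    for c :: "real ^ 'm::{finite,linorder}" and r
    by (simp add: emeasure_ball V_def)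
  have meas: "A r \<in> sets lborel" for r
    unfolding A_def using finQ[of r] by (intro sets.finite_UN) auto
  have V: "V \<ge> 0" by (simp add: V_def)
  have vol: "emeasure lborel (A r) \<le> ennreal (2 * V * (2 powr (s - ?m)) ^ r)" for r
  proof -
    have "emeasure lborel (A r) \<le> (\<Sum>q\<in>Q r. emeasure lborel (ball (real_point q) ((1 / 2) ^ r)))"
      unfolding A_def using finQ[of r] by (intro emeasure_subadditive_finite) auto
    also have "\<dots> = ennreal (real (card (Q r)) * (V * ((1 / 2) ^ r) ^ ?m))"
      using V by (simp add: ball ennreal_of_nat_eq_real_of_nat ennreal_mult)
    also have "\<dots> \<le> ennreal (2 * 2 powr (s * real r) * (V * ((1 / 2) ^ r) ^ ?m))"
      by (intro ennreal_leI mult_right_mono cardQ) (use V in auto)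
    also have "2 * 2 powr (s * real r) * (V * ((1 / 2) ^ r) ^ ?m) = 2 * V * (2 powr (s - ?m)) ^ r"
    proof -
      have "((1 / 2 :: real) ^ r) ^ ?m = 2 powr - (?m * real r)"
        by (simp add: powr_minus powr_realpow power_one_over inverse_eq_divide mult.commute
            flip: power_mult of_nat_mult)
      moreover have "(2 powr (s - ?m)) ^ r = 2 powr (s * real r) * 2 powr - (?m * real r)"
        by (simp add: powr_power algebra_simps flip: powr_add)
      ultimately show ?thesis by simp
    qed
    finally show ?thesis .
  qed
  have ratio: "norm (2 powr (s - ?m)) < 1"
    using s by (simp add: powr_less_one)
  have "summable (\<lambda>r. measure lborel (A r))"
  proof (rule summable_comparison_test_ev)
    show "summable (\<lambda>r. 2 * V * (2 powr (s - ?m)) ^ r)"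
      by (intro summable_mult summable_geometric ratio)
    show "\<forall>\<^sub>F r in sequentially. norm (measure lborel (A r)) \<le> 2 * V * (2 powr (s - ?m)) ^ r"
      using vol V by (auto intro!: always_eventually enn2real_leI simp: measure_def)
  qed
  moreover have "emeasure lborel (A r) < \<infinity>" for r
    by (rule le_less_trans[OF vol]) simp
  ultimately have "AE z in lborel. \<forall>\<^sub>F r in sequentially. z \<in> space lborel - A r"
    using meas by (intro borel_cantelli_AE1) auto
  then show ?thesis
  proof (rule AE_mp, intro AE_I2 impI)
    fix z :: "real ^ 'm::{finite,linorder}"
    assume ev: "\<forall>\<^sub>F r in sequentially. z \<in> space lborel - A r"
    have ge: "s \<le> real (complexity_at U e r z) / real r"
      if "z \<notin> A r" "r > 0" for r
    proof -
      obtain q where q: "real_point q \<in> ball z ((1 / 2) ^ r)"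
        "complexity_at U e r z = complexity U e q"
        using complexity_at_attained by blast
      have "q \<notin> Q r" using that(1) q(1) by (auto simp: A_def dist_commute)
      then have "s * real r \<le> real (complexity U e q)"
        unfolding Q_def by simp linarith
      then show ?thesis using q(2) that(2) by (simp add: field_simps)
    qed
    have "\<forall>\<^sub>F r in sequentially.
        ereal s \<le> ereal (real (complexity_at U e r z) / real r)"
      using ev eventually_gt_at_top[of "0::nat"] by eventually_elim (use ge in auto)
    then show "ereal s \<le> effective_dim U e z"
      unfolding effective_dim_def by (rule Liminf_bounded)
  qed
qed

text \<open>
  A nonzero first coordinate makes the line from the origin through the point the graph of a
  linear polynomial; it excludes only a null set.
\<close>

lemma exists_planar_point_dim_ge:
  assumes "universal_prefix_machine U" and "inj e" and "0 \<le> s" and "s < 2"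
  shows "\<exists>z :: real ^ 2. z $ 1 \<noteq> 0 \<and> ereal s \<le> effective_dim U e z"
proof -
  have "AE z :: real ^ 2 in lborel. ereal s \<le> effective_dim U e z"
    using assms by (intro AE_effective_dim_ge) auto
  moreover have "AE z :: real ^ 2 in lborel. z $ 1 \<noteq> 0"
    using AE_lborel_inner_neq[of "axis 1 1 :: real ^ 2" 0]
    by (simp add: axis_in_Basis_iff inner_axis)
  ultimately have "AE z :: real ^ 2 in lborel. z $ 1 \<noteq> 0 \<and> ereal s \<le> effective_dim U e z"
    by eventually_elim simp
  moreover have "ae_filter (lborel :: (real ^ 2) measure) \<noteq> bot"
    by (simp add: ae_filter_eq_bot_iff)
  ultimately show ?thesis
    by (metis (mono_tags, lifting) eventually_happens')
qed

lemma mem_poly_graph_iff: "z \<in> poly_graph P \<longleftrightarrow> z $ 2 = poly P (z $ 1)"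
  by (auto simp: poly_graph_def vec_eq_iff forall_2)

theorem lemma31:
  fixes U :: tm and e :: "rat list \<Rightarrow> bool list"
  assumes "universal_prefix_machine U" and "rat_tuple_encoding e"
  shows "\<exists>C :: real poly set. C \<noteq> {} \<and>
           (\<forall>P\<in>C. spectrum_diam (dim_spectrum U e (poly_graph P)) > 1)"
proof -
  have "inj e" using assms(2) by (simp add: rat_tuple_encoding_def)
  \<comment> \<open>Any value strictly between \<open>1\<close> and \<open>2\<close> serves in place of \<open>3 / 2\<close>.\<close>
  then obtain z :: "real ^ 2" where z: "z $ 1 \<noteq> 0" "ereal (3 / 2) \<le> effective_dim U e z"
    using exists_planar_point_dim_ge[OF assms(1), of e "3 / 2"] by auto
  define P where "P = [:0, z $ 2 / z $ 1:]"
  let ?S = "dim_spectrum U e (poly_graph P)"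
  have "z \<in> poly_graph P" using z(1) by (simp add: mem_poly_graph_iff P_def)
  then have "effective_dim U e z \<in> ?S" by (simp add: dim_spectrum_def)
  moreover have "0 \<in> ?S"
  proof -
    have "real_point (0 :: rat ^ 2) \<in> poly_graph P" by (simp add: mem_poly_graph_iff P_def)
    then show ?thesis
      using effective_dim_rational[of U e "0 :: rat ^ 2"] unfolding dim_spectrum_def
      by (metis imageI)
  qed
  ultimately have "\<bar>effective_dim U e z - 0\<bar> \<le> spectrum_diam ?S"
    unfolding spectrum_diam_def by (intro SUP_upper2[of "(effective_dim U e z, 0)"]) auto
  moreover have "1 < ereal (3 / 2)" by simp
  moreover have "ereal (3 / 2) \<le> \<bar>effective_dim U e z - 0\<bar>"
    using z(2) by (cases "effective_dim U e z") auto
  ultimately have "1 < spectrum_diam ?S" by order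
  then show ?thesis by (intro exI[of _ "{P}"]) simp
qed

end
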